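(* Let ${}_R G$ be a module and let $\mathbb{F}$ be a finite field whose characteristic divides $|G|$. For each network $\mathcal{N}$ (with $m$ message vectors) and all integers $k_1,\dots,k_m\ge 0$ and $n\ge 1$ such that $\mathcal{N}$ has a $(k_1,\dots,k_m,n)$ linear solution over ${}_R G$, there exists a positive integer $t$ such that $\mathcal{N}$ has a $(tk_1,\dots,tk_m,tn)$ linear solution over $\mathbb{F}$.
   Context: Rings are associative with identity $1$, not necessarily commutative. A module ${}_R G$ is a left (unital) $R$-module $G$ whose underlying Abelian group $G$ is finite; the ring $R$ need not be finite. A network is a finite directed acyclic multigraph, some of whose nodes are sources or receivers, with finitely many message vectors (say $m$ of them), each originating at a source node; each receiver demands a specified set of the message vectors. The inputs of a node are the message vectors originating at the node together with the vectors carried by its incoming edges. For integers $k_1,\dots,k_m\ge 0$ and $n\ge 1$, a $(k_1,\dots,k_m,n)$ code over a finite alphabet $\mathcal{A}$ (with $|\mathcal{A}|\ge 2$) lets the $i$th message vector range over $\mathcal{A}^{k_i}$, assigns to each edge an edge function mapping the inputs of the edge's tail node to a vector in $\mathcal{A}^n$ (the vector carried by the edge), and assigns to each receiver and each message vector it demands a decoding function of the receiver's inputs. The code is a solution if, for all values of the message vectors, each decoding function outputs the demanded message vector. A code over the alphabet $\mathcal{A}=G$ is linear over the module ${}_R G$ if every edge function and decoding function is of the form $\mathbf{x}\mapsto A\mathbf{x}$, where $\mathbf{x}$ is the concatenation (a vector over $G$) of the input vectors of the node, $A$ is a matrix with entries in $R$, and entries of $A$ multiply entries of $\mathbf{x}$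 via the module action. Linear over a field $\mathbb{F}$ means linear over the module ${}_{\mathbb{F}}\mathbb{F}$ ($\mathbb{F}$ acting on itself by multiplication). *)

theory Defs
  imports "HOL-Library.FuncSet" "HOL-Computational_Algebra.Computational_Algebra"
    "Graph_Theory.Digraph"
begin

section \<open>Left modules over a not necessarily commutative ring\<close>

text \<open>The locales called \<open>module\<close> in HOL and in HOL-Algebra require a commutative ring.\<close>

locale left_module =
  fixes scale :: "'r::ring_1 \<Rightarrow> 'g::ab_group_add \<Rightarrow> 'g"  (infixr \<open>*s\<close> 75)
  assumes scale_add_right: "a *s (x + y) = a *s x + a *s y"
    and scale_add_left: "(a + b) *s x = a *s x + b *s x"
    and scale_scale: "a *s (b *s x) = (a * b) *s x"
    and scale_one: "1 *s x = x"

lemma left_module_self: "left_module ((*) :: 'r::ring_1 \<Rightarrow> 'r \<Rightarrow> 'r)"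
  by unfold_locales (simp_all add: algebra_simps)


section \<open>Networks\<close>

text \<open>
  The messages are numbered \<open>0, \<dots>, num_msgs N - 1\<close>; the values of \<open>origin N\<close> at other numbers,
  and of \<open>demands N\<close> at nodes that are not receivers, are irrelevant.
\<close>

record ('v, 'e) network =
  net_graph :: "('v, 'e) pre_digraph"
  sources :: "'v set"
  receivers :: "'v set"
  num_msgs :: nat
  origin :: "nat \<Rightarrow> 'v"
  demands :: "'v \<Rightarrow> nat set"

locale network = fin_digraph "net_graph N" for N :: "('v, 'e) network" +
  assumes acyclic: "acyclic (arcs_ends (net_graph N))"
    and sources_subset: "sources N \<subseteq> verts (net_graph N)"
    and receivers_subset: "receivers N \<subseteq> verts (net_graph N)"
    and origin_source: "i < num_msgs N \<Longrightarrow> origin N i \<in> sources N"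
    and demands_subset: "v \<in> receivers N \<Longrightarrow> demands N v \<subseteq> {..<num_msgs N}"

datatype 'e input = Message nat | Edge 'e

definition node_inputs :: "('v, 'e) network \<Rightarrow> 'v \<Rightarrow> 'e input set" where
  "node_inputs N v =
     Message ` {i. i < num_msgs N \<and> origin N i = v} \<union> Edge ` in_arcs (net_graph N) v"


section \<open>Codes\<close>

text \<open>
  The alphabet is the type \<open>'a\<close>, and an element of the \<open>l\<close>-th power of the alphabet is a list of
  length \<open>l\<close>.
\<close>

fun input_dim :: "(nat \<Rightarrow> nat) \<Rightarrow> nat \<Rightarrow> 'e input \<Rightarrow> nat" where
  "input_dim k n (Message i) = k i"
| "input_dim k n (Edge e) = n"

definition input_space ::
    "('v, 'e) network \<Rightarrow> (nat \<Rightarrow> nat) \<Rightarrow> nat \<Rightarrow> 'v \<Rightarrow> ('e input \<Rightarrow> 'a list) set" where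
  "input_space N k n v = (\<Pi>\<^sub>E s\<in>node_inputs N v. {xs. length xs = input_dim k n s})"

text \<open>
  The inputs actually received at \<open>v\<close> when the messages are \<open>w\<close> and the edges carry \<open>c\<close>. The
  restriction ensures that edge and decoding functions see nothing but the inputs of their node.
\<close>

definition received ::
    "('v, 'e) network \<Rightarrow> (nat \<Rightarrow> 'a list) \<Rightarrow> ('e \<Rightarrow> 'a list) \<Rightarrow> 'v \<Rightarrow> 'e input \<Rightarrow> 'a list" where
  "received N w c v = restrict (case_input w c) (node_inputs N v)"

text \<open>
  The vectors carried by the edges, for edge functions \<open>f\<close> and messages \<open>w\<close>, by recursion along
  the acyclic graph; \<open>carried_eq\<close> below is the recursion equation.
\<close>

definition carried ::
    "('v, 'e) network \<Rightarrow> ('e \<Rightarrow> ('e input \<Rightarrow> 'a list) \<Rightarrow> 'a list) \<Rightarrow> (nat \<Rightarrow> 'a list) \<Rightarrow> 'e \<Rightarrow> 'a list"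
  where
  "carried N f w =
     wfrec {(d, e). d \<in> arcs (net_graph N) \<and> e \<in> arcs (net_graph N) \<and>
                    head (net_graph N) d = tail (net_graph N) e}
       (\<lambda>c e. f e (received N w c (tail (net_graph N) e)))"

lemma (in network) wf_edges:
  "wf {(d, e). d \<in> arcs (net_graph N) \<and> e \<in> arcs (net_graph N) \<and>
               head (net_graph N) d = tail (net_graph N) e}" (is "wf ?R")
proof -
  let ?G = "net_graph N"
  have "finite (arcs_ends ?G)"
    by (simp add: arcs_ends_def)
  then have "wf (arcs_ends ?G)"
    using acyclic by (rule finite_acyclic_wf)
  then have "wf (inv_image (arcs_ends ?G) (tail ?G))"
    by (rule wf_inv_image)
  then show ?thesis
    by (rule wf_subset) (auto simp: inv_image_def arcs_ends_conv intro: rev_image_eqI)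
qed

lemma (in network) carried_eq:
  assumes "e \<in> arcs (net_graph N)"
  shows "carried N f w e = f e (received N w (carried N f w) (tail (net_graph N) e))"
proof -
  let ?R = "{(d, e). d \<in> arcs (net_graph N) \<and> e \<in> arcs (net_graph N) \<and>
                     head (net_graph N) d = tail (net_graph N) e}"
  have "received N w (cut (carried N f w) ?R e) (tail (net_graph N) e) =
        received N w (carried N f w) (tail (net_graph N) e)"
    using assms
    by (auto simp: received_def restrict_def node_inputs_def in_arcs_def cut_def fun_eq_iff)
  then show ?thesis
    using wfrec[OF wf_edges, of "\<lambda>c e. f e (received N w c (tail (net_graph N) e))" e]
    by (simp add: carried_def)
qed

text \<open>
  In a code, \<open>f e\<close> is the edge function of \<open>e\<close> and \<open>d v i\<close> is the decoding function of the
  receiver \<open>v\<close> for the message \<open>i\<close>.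
\<close>

locale network_code = network N for N :: "('v, 'e) network" +
  fixes k :: "nat \<Rightarrow> nat" and n :: nat
    and f :: "'e \<Rightarrow> ('e input \<Rightarrow> 'a list) \<Rightarrow> 'a list"
    and d :: "'v \<Rightarrow> nat \<Rightarrow> ('e input \<Rightarrow> 'a list) \<Rightarrow> 'a list"
  assumes finite_alphabet: "finite (UNIV :: 'a set)"
    and card_alphabet: "2 \<le> card (UNIV :: 'a set)"
    and n_pos: "1 \<le> n"
    and edge_fun: "e \<in> arcs (net_graph N) \<Longrightarrow> x \<in> input_space N k n (tail (net_graph N) e) \<Longrightarrow>
                     length (f e x) = n"
    and decode_fun: "v \<in> receivers N \<Longrightarrow> i \<in> demands N v \<Longrightarrow> x \<in> input_space N k n v \<Longrightarrow>
                       length (d v i x) = k i"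

definition is_solution ::
    "('v, 'e) network \<Rightarrow> (nat \<Rightarrow> nat) \<Rightarrow> nat \<Rightarrow> ('e \<Rightarrow> ('e input \<Rightarrow> 'a list) \<Rightarrow> 'a list) \<Rightarrow>
     ('v \<Rightarrow> nat \<Rightarrow> ('e input \<Rightarrow> 'a list) \<Rightarrow> 'a list) \<Rightarrow> bool" where
  "is_solution N k n f d \<longleftrightarrow> network_code N k n f d \<and>
     (\<forall>w. (\<forall>i<num_msgs N. length (w i) = k i) \<longrightarrow>
        (\<forall>v\<in>receivers N. \<forall>i\<in>demands N v. d v i (received N w (carried N f w) v) = w i))"


section \<open>Linear codes\<close>

text \<open>
  The coordinates of the concatenation of the inputs of \<open>v\<close> are the pairs \<open>(s, j)\<close> of an input
  \<open>s\<close> and a position \<open>j\<close> in it. They index the columns of the matrix \<open>A\<close>, so that no order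
  on the inputs of \<open>v\<close> has to be chosen.
\<close>

definition input_coords ::
    "('v, 'e) network \<Rightarrow> (nat \<Rightarrow> nat) \<Rightarrow> nat \<Rightarrow> 'v \<Rightarrow> ('e input \<times> nat) set" where
  "input_coords N k n v = (SIGMA s:node_inputs N v. {..<input_dim k n s})"

definition linear_node_fun ::
    "('r::ring_1 \<Rightarrow> 'g::ab_group_add \<Rightarrow> 'g) \<Rightarrow> ('v, 'e) network \<Rightarrow> (nat \<Rightarrow> nat) \<Rightarrow> nat \<Rightarrow> 'v \<Rightarrow>
     nat \<Rightarrow> (('e input \<Rightarrow> 'g list) \<Rightarrow> 'g list) \<Rightarrow> bool" where
  "linear_node_fun scale N k n v rows h \<longleftrightarrow>
     (\<exists>A :: nat \<Rightarrow> 'e input \<times> nat \<Rightarrow> 'r. \<forall>x\<in>input_space N k n v.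
        h x = map (\<lambda>a. \<Sum>(s, j)\<in>input_coords N k n v. scale (A a (s, j)) (x s ! j)) [0..<rows])"

definition is_linear_code ::
    "('r::ring_1 \<Rightarrow> 'g::ab_group_add \<Rightarrow> 'g) \<Rightarrow> ('v, 'e) network \<Rightarrow> (nat \<Rightarrow> nat) \<Rightarrow> nat \<Rightarrow>
     ('e \<Rightarrow> ('e input \<Rightarrow> 'g list) \<Rightarrow> 'g list) \<Rightarrow>
     ('v \<Rightarrow> nat \<Rightarrow> ('e input \<Rightarrow> 'g list) \<Rightarrow> 'g list) \<Rightarrow> bool" where
  "is_linear_code scale N k n f d \<longleftrightarrow> network_code N k n f d \<and>
     (\<forall>e\<in>arcs (net_graph N). linear_node_fun scale N k n (tail (net_graph N) e) n (f e)) \<and>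
     (\<forall>v\<in>receivers N. \<forall>i\<in>demands N v. linear_node_fun scale N k n v (k i) (d v i))"

definition has_linear_solution ::
    "('r::ring_1 \<Rightarrow> 'g::ab_group_add \<Rightarrow> 'g) \<Rightarrow> ('v, 'e) network \<Rightarrow> (nat \<Rightarrow> nat) \<Rightarrow> nat \<Rightarrow> bool" where
  "has_linear_solution scale N k n \<longleftrightarrow>
     (\<exists>f d. is_linear_code scale N k n f d \<and> is_solution N k n f d)"

end

theory Submission
  imports Defs "HOL-Algebra.Sylow"
begin

text \<open>
  Let \<open>p\<close> be the characteristic of the field. The \<open>p\<close>-torsion of the module is a nonzero
  submodule and a vector space over the prime field, of some dimension \<open>t\<close>, on which each ring
  element acts as a \<open>t \<times> t\<close> matrix. Replacing the entries of the matrices of the given code by these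
  blocks gives a code over the field. On messages with entries in the prime field it simulates
  the given code on torsion messages, so there it decodes correctly. These messages contain the
  unit vectors, and the decoded messages depend linearly on the messages over the field, so it
  decodes correctly on all messages.
\<close>


section \<open>The torsion submodule\<close>

context left_module
begin

section \<open>Arithmetic of the module action\<close>

lemma scale_zero_right: "a *s 0 = 0"
  using scale_add_right[of a 0 0] by simp

lemma scale_zero_left: "0 *s x = 0"
  using scale_add_left[of 0 0 x] by simp

lemma scale_minus_right: "a *s (- x) = - (a *s x)"
  by (metis add.right_inverse add_eq_0_iff scale_add_right scale_zero_right)

lemma scale_minus_left: "(- a) *s x = - (a *s x)"
  by (metis add.right_inverse add_eq_0_iff scale_add_left scale_zero_left)

lemma scale_sum_right: "a *s (\<Sum>i\<in>A. h i) = (\<Sum>i\<in>A. a *s h i)"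
  by (induction A rule: infinite_finite_induct) (simp_all add: scale_zero_right scale_add_right)

lemma scale_of_nat: "of_nat m *s x = (\<Sum>i<m. x)"
  by (induction m) (simp_all add: scale_zero_left scale_add_left scale_one add.commute)

text \<open>Integer multiples of 1 are central in every ring, so integers act by module
  endomorphisms; hence the kernel of multiplication by \<open>p\<close> is a submodule.\<close>

lemma scale_of_int_commute: "of_int m *s (r *s x) = r *s (of_int m *s x)"
  by (simp add: scale_scale mult_of_int_commute)

text \<open>Cauchy's theorem: Sylow's theorem with exponent 1 gives a subgroup of order
  \<open>p\<close>, and each of its elements is annihilated by that order.\<close>

lemma ex_torsion:
  assumes fin: "finite (UNIV :: 'g set)" and p: "prime p" "p dvd card (UNIV :: 'g set)"
  shows "\<exists>x. x \<noteq> 0 \<and> of_nat p *s x = 0"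
proof -
  let ?G = "\<lparr>carrier = UNIV, mult = (+), one = 0 :: 'g\<rparr>"
  have G: "group ?G"
    by (rule groupI) (auto simp: add.assoc intro: exI[of _ "- x" for x] left_minus)
  from p(2) obtain m where "card (UNIV :: 'g set) = p ^ 1 * m"
    by auto
  then obtain H where H: "subgroup H ?G" "card H = p ^ 1"
    using sylow_thm[OF p(1) G, of 1 m] fin by (auto simp: order_def)
  have "finite H" "H \<noteq> {0}"
    using H(2) p(1) by (auto intro: finite_subset[OF _ fin])
  then obtain x where x: "x \<in> H" "x \<noteq> 0"
    using subgroup.one_closed[OF H(1)] by auto
  have add: "x + y \<in> H" if "y \<in> H" for y
    using subgroup.m_closed[OF H(1) x(1) that] by simp
  \<comment> \<open>Translation by \<open>x\<close> permutes \<open>H\<close>, so it does not change the sum over \<open>H\<close>.\<close>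
  have "(+) x ` H = H"
    by (rule endo_inj_surj) (use \<open>finite H\<close> add in \<open>auto simp: inj_on_def\<close>)
  then have "(\<Sum>y\<in>H. y) = (\<Sum>y\<in>H. x + y)"
    using sum.reindex[of "(+) x" H "\<lambda>y. y"] by (simp add: inj_on_def)
  then have "(\<Sum>y\<in>H. x) = 0"
    by (simp add: sum.distrib)
  moreover have "(\<Sum>y\<in>H. x) = (\<Sum>i<p. x)"
    using sum.reindex_bij_betw[OF bij_betw_from_nat_into_finite[OF \<open>finite H\<close>], of "\<lambda>_. x"] H(2)
    by simp
  ultimately show ?thesis
    using x(2) by (auto simp: scale_of_nat)
qed

text \<open>Integer coefficients stand in for elements of the prime field: they map both into the
  ring and into any field of characteristic \<open>p\<close>, and on \<open>p\<close>-torsion only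
  their residues modulo \<open>p\<close> matter.\<close>

abbreviation combination :: "('g \<Rightarrow> int) \<Rightarrow> 'g set \<Rightarrow> 'g" where
  "combination c B \<equiv> \<Sum>y\<in>B. of_int (c y) *s y"

text \<open>The \<open>p\<close>-torsion is a vector space over the integers modulo
  \<open>p\<close>, and the last property is linear independence there. A minimal generating set is
  independent, because a relation with a coefficient prime to \<open>p\<close> can be solved for
  that generator.\<close>

lemma torsion_basis:
  assumes fin: "finite (UNIV :: 'g set)" and p: "prime p"
  obtains B where "\<And>y. y \<in> B \<Longrightarrow> of_nat p *s y = 0"
    and "\<And>x. of_nat p *s x = 0 \<Longrightarrow> \<exists>c. x = combination c B"
    and "\<And>c y. combination c B = 0 \<Longrightarrow> y \<in> B \<Longrightarrow> int p dvd c y"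
proof -
  let ?T = "{x. of_nat p *s x = 0}"
  define gen where
    "gen B \<longleftrightarrow> B \<subseteq> ?T \<and> (\<forall>x\<in>?T. \<exists>c. x = combination c B)" for B
  \<comment> \<open>A basis is obtained as a generating set of minimal size.\<close>
  have "gen ?T"
    unfolding gen_def
  proof (intro conjI ballI subset_refl)
    fix x assume x: "x \<in> ?T"
    have "combination (\<lambda>y. if y = x then 1 else 0) ?T = (\<Sum>y\<in>?T. if y = x then x else 0)"
      by (intro sum.cong) (auto simp: scale_zero_left scale_one)
    then show "\<exists>c. x = combination c ?T"
      using x finite_subset[OF subset_UNIV fin] by (auto intro!: exI[of _ "\<lambda>y. if y = x then 1 else 0"])
  qed
  then obtain B where B: "gen B" and min: "\<And>B'. gen B' \<Longrightarrow> card B \<le> card B'"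
    using ex_has_least_nat[of gen ?T card] by blast
  have finB: "finite B"
    by (rule finite_subset[OF subset_UNIV fin])
  have "int p dvd c z" if c: "combination c B = 0" and z: "z \<in> B" for c z
  proof (rule ccontr)
    assume "\<not> int p dvd c z"
    then have "coprime (c z) (int p)"
      using p by (metis coprime_commute prime_imp_coprime prime_nat_int_transfer)
    \<comment> \<open>\<open>u\<close> inverts \<open>c z\<close> modulo \<open>p\<close>; as
      \<open>p\<close> annihilates \<open>z\<close>, acting by \<open>u\<close> on
      \<open>of_int (c z) *s z\<close> gives back \<open>z\<close>.\<close>
    then obtain u v where uv: "u * c z + v * int p = 1"
      by (metis bezout_int coprime_imp_gcd_eq_1)
    have pz: "of_nat p *s z = 0"
      using B z by (auto simp: gen_def)
    have cz: "of_int (c z) *s z = - combination c (B - {z})"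
      using c by (simp add: sum.remove[OF finB z] eq_neg_iff_add_eq_0)
    have "z = of_int (u * c z + v * int p) *s z"
      by (simp add: uv scale_one)
    also have "\<dots> = of_int u *s (of_int (c z) *s z)"
      by (simp add: scale_add_left flip: scale_scale) (simp add: pz scale_zero_right)
    finally have z_eq: "z = - (of_int u *s combination c (B - {z}))"
      by (simp add: cz scale_minus_right)
    \<comment> \<open>Substituting \<open>z_eq\<close> into any combination eliminates
      \<open>z\<close>, which leaves a generating set smaller than \<open>B\<close>.\<close>
    have "gen (B - {z})"
      unfolding gen_def
    proof (intro conjI ballI)
      show "B - {z} \<subseteq> ?T"
        using B by (auto simp: gen_def)
    next
      fix x assume "x \<in> ?T"
      then obtain e where "x = combination e B"
        using B by (auto simp: gen_def)
      then have "x = of_int (e z) *s z + combination e (B - {z})"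
        by (simp add: sum.remove[OF finB z])
      also have "of_int (e z) *s z = - (of_int (e z) *s (of_int u *s combination c (B - {z})))"
        by (subst z_eq) (simp add: scale_minus_right)
      also have "\<dots> + combination e (B - {z}) =
          combination (\<lambda>y. e y - e z * u * c y) (B - {z})"
        by (simp add: scale_sum_right scale_scale scale_add_left scale_minus_left mult.assoc
            sum.distrib sum_negf diff_conv_add_uminus add.commute del: add_uminus_conv_diff)
      finally show "\<exists>c. x = combination c (B - {z})"
        by (intro exI[of _ "\<lambda>y. e y - e z * u * c y"])
    qed
    then show False
      using min[of "B - {z}"] card_Diff1_less[OF finB z] by simp
  qed
  then show thesis
    using that[of B] B by (auto simp: gen_def)
qed

end

text \<open>
  \<open>\<phi>\<close> expresses the elements of a submodule \<open>S\<close> in coordinates over a field with respect to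
  \<open>b\<close>, and \<open>\<rho> r\<close> is the matrix of the action of \<open>r\<close>.
\<close>

locale module_representation = left_module scale
  for scale :: "'r::ring_1 \<Rightarrow> 'g::ab_group_add \<Rightarrow> 'g"  (infixr \<open>*s\<close> 75) +
  fixes S :: "'g set" and t :: nat and b :: "nat \<Rightarrow> 'g"
    and \<phi> :: "'g \<Rightarrow> nat \<Rightarrow> 'f::field" and \<rho> :: "'r \<Rightarrow> nat \<Rightarrow> nat \<Rightarrow> 'f"
  assumes t_pos: "0 < t"
    and zero_mem: "0 \<in> S"
    and add_mem: "x \<in> S \<Longrightarrow> y \<in> S \<Longrightarrow> x + y \<in> S"
    and scale_mem: "x \<in> S \<Longrightarrow> r *s x \<in> S"
    and basis_mem: "j < t \<Longrightarrow> b j \<in> S"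
    and \<phi>_add: "x \<in> S \<Longrightarrow> y \<in> S \<Longrightarrow> i < t \<Longrightarrow> \<phi> (x + y) i = \<phi> x i + \<phi> y i"
    and \<phi>_scale: "x \<in> S \<Longrightarrow> i < t \<Longrightarrow> \<phi> (r *s x) i = (\<Sum>j<t. \<rho> r i j * \<phi> x j)"
    and \<phi>_basis: "i < t \<Longrightarrow> j < t \<Longrightarrow> \<phi> (b j) i = (if i = j then 1 else 0)"

text \<open>With respect to a basis of the torsion, integer coordinates are unique modulo the
  characteristic, so their images in the field are well defined. The dimension is positive because
  divisibility of the order yields nonzero torsion.\<close>

lemma (in left_module) torsion_representation:
  assumes fin: "finite (UNIV :: 'g set)"
    and char: "CHAR('f::{field, finite}) dvd card (UNIV :: 'g set)"
  shows "\<exists>S t b (\<phi> :: 'g \<Rightarrow> nat \<Rightarrow> 'f) \<rho>. module_representation (*s) S t b \<phi> \<rho>"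
proof -
  let ?p = "CHAR('f)"
  have p: "prime ?p"
    by (rule prime_CHAR_semidom) (simp add: finite_imp_CHAR_pos)
  obtain B where B: "\<And>y. y \<in> B \<Longrightarrow> of_nat ?p *s y = 0"
    and gen: "\<And>x. of_nat ?p *s x = 0 \<Longrightarrow> \<exists>c. x = combination c B"
    and ind: "\<And>c y. combination c B = 0 \<Longrightarrow> y \<in> B \<Longrightarrow> int ?p dvd c y"
    using torsion_basis[OF fin p] by blast
  have finB: "finite B"
    by (rule finite_subset[OF subset_UNIV fin])
  let ?S = "{x. of_nat ?p *s x = 0}"
  obtain b where b: "bij_betw b {..<card B} B"
    using ex_bij_betw_nat_finite[OF finB] by (auto simp: atLeast0LessThan)
  \<comment> \<open>The choice of \<open>c\<close> is arbitrary; \<open>\<phi>_eq\<close> below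
    shows that any other integer coordinates have the same images in the field.\<close>
  obtain c where c: "\<And>x. x \<in> ?S \<Longrightarrow> x = combination (c x) B"
    using gen by (metis (mono_tags) mem_Collect_eq)
  define \<phi> :: "'g \<Rightarrow> nat \<Rightarrow> 'f" where "\<phi> x i = of_int (c x (b i))" for x i
  have bB: "b i \<in> B" if "i < card B" for i
    using b that by (auto simp: bij_betw_def)
  have \<phi>_eq: "\<phi> x i = of_int (e (b i))" if "x \<in> ?S" "x = combination e B" "i < card B" for x e i
  proof -
    have "combination (\<lambda>y. c x y - e y) B = combination (c x) B - combination e B"
      by (simp add: scale_add_left scale_minus_left sum_subtractf diff_conv_add_uminus sum.distrib sum_negf
          del: add_uminus_conv_diff)
    also have "\<dots> = 0"
      using c[OF that(1)] that(2) by simp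
    finally have "int ?p dvd c x (b i) - e (b i)"
      using ind[of "\<lambda>y. c x y - e y"] bB[OF that(3)] by simp
    then have "of_int (c x (b i) - e (b i)) = (0 :: 'f)"
      by (simp only: of_int_eq_0_iff_char_dvd)
    then show ?thesis
      by (simp add: \<phi>_def)
  qed
  have mem: "r *s x \<in> ?S" if "x \<in> ?S" for r x
    using that scale_of_int_commute[of "int ?p" r x] by (simp add: scale_zero_right)
  have bS: "b i \<in> ?S" if "i < card B" for i
    using bB[OF that] B by simp
  \<comment> \<open>The matrix of \<open>r\<close> is the usual one: its columns are the coordinates
    of the images of the basis vectors.\<close>
  have "module_representation (*s) ?S (card B) b \<phi> (\<lambda>r i j. \<phi> (r *s b j) i)"
  proof unfold_locales
    obtain x where x: "x \<noteq> 0" "of_nat ?p *s x = 0"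
      using ex_torsion[OF fin p char] by blast
    then have "B \<noteq> {}"
      using gen[of x] by auto
    then show "0 < card B"
      using finB by (simp add: card_gt_0_iff)
  next
    show "0 \<in> ?S"
      by (simp add: scale_zero_right)
  next
    fix x y assume "x \<in> ?S" "y \<in> ?S"
    then show "x + y \<in> ?S"
      by (simp add: scale_add_right)
  next
    fix x y i assume xy: "x \<in> ?S" "y \<in> ?S" and i: "i < card B"
    have "x + y = combination (c x) B + combination (c y) B"
      using c[OF xy(1)] c[OF xy(2)] by simp
    also have "\<dots> = combination (\<lambda>z. c x z + c y z) B"
      by (simp add: scale_add_left sum.distrib)
    finally have eq: "x + y = combination (\<lambda>z. c x z + c y z) B" .
    have "x + y \<in> ?S"
      using xy by (simp add: scale_add_right)
    from \<phi>_eq[OF this eq i] show "\<phi> (x + y) i = \<phi> x i + \<phi> y i"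
      by (simp add: \<phi>_def)
  next
    fix x i r assume x: "x \<in> ?S" and i: "i < card B"
    \<comment> \<open>Expand \<open>x\<close> in \<open>B\<close>, move \<open>r\<close> past the
      integers, expand each \<open>r *s y\<close> again, and collect the coefficient of each
      \<open>z\<close>.\<close>
    have "r *s x = (\<Sum>y\<in>B. of_int (c x y) *s (r *s y))"
      by (subst c[OF x]) (simp add: scale_sum_right scale_of_int_commute)
    also have "\<dots> = (\<Sum>y\<in>B. of_int (c x y) *s combination (c (r *s y)) B)"
      using c mem B by (intro sum.cong refl arg_cong2[where f = "(*s)"]) auto
    also have "\<dots> = (\<Sum>z\<in>B. \<Sum>y\<in>B. of_int (c x y * c (r *s y) z) *s z)"
      by (simp add: scale_sum_right scale_scale) (rule sum.swap)
    also have "\<dots> = combination (\<lambda>z. \<Sum>y\<in>B. c x y * c (r *s y) z) B"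
    proof (rule sum.cong[OF refl])
      fix z
      have "of_int (\<Sum>y\<in>A. h y) *s z = (\<Sum>y\<in>A. of_int (h y) *s z)" for h and A :: "'g set"
        by (induction A rule: infinite_finite_induct) (simp_all add: scale_zero_left scale_add_left)
      then show "(\<Sum>y\<in>B. of_int (c x y * c (r *s y) z) *s z) =
          of_int (\<Sum>y\<in>B. c x y * c (r *s y) z) *s z"
        by metis
    qed
    finally have eq: "r *s x = combination (\<lambda>z. \<Sum>y\<in>B. c x y * c (r *s y) z) B" .
    have "\<phi> (r *s x) i = (\<Sum>y\<in>B. of_int (c x y) * of_int (c (r *s y) (b i)))"
      using \<phi>_eq[OF mem[OF x] eq i] by simp
    also have "\<dots> = (\<Sum>j<card B. of_int (c x (b j)) * of_int (c (r *s b j) (b i)))"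
      by (rule sum.reindex_bij_betw[OF b, symmetric])
    finally show "\<phi> (r *s x) i = (\<Sum>j<card B. \<phi> (r *s b j) i * \<phi> x j)"
      by (simp add: \<phi>_def mult.commute)
  next
    fix i j assume ij: "i < card B" "j < card B"
    have "combination (\<lambda>y. if y = b j then 1 else 0) B = (\<Sum>y\<in>B. if y = b j then b j else 0)"
      by (intro sum.cong) (auto simp: scale_zero_left scale_one)
    then have eq: "b j = combination (\<lambda>y. if y = b j then 1 else 0) B"
      using finB bB[OF ij(2)] by simp
    have "b i = b j \<longleftrightarrow> i = j"
      using b ij by (auto simp: bij_betw_def inj_on_def)
    then show "\<phi> (b j) i = (if i = j then 1 else 0)"
      using \<phi>_eq[OF bS[OF ij(2)] eq ij(1)] by simp
  qed (use mem bS in auto)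
  then show ?thesis
    by blast
qed


section \<open>Linear functionals on messages\<close>

definition apply_matrix ::
    "('r::ring_1 \<Rightarrow> 'g::ab_group_add \<Rightarrow> 'g) \<Rightarrow> ('v, 'e) network \<Rightarrow> (nat \<Rightarrow> nat) \<Rightarrow> nat \<Rightarrow> 'v \<Rightarrow>
     nat \<Rightarrow> (nat \<Rightarrow> 'e input \<times> nat \<Rightarrow> 'r) \<Rightarrow> ('e input \<Rightarrow> 'g list) \<Rightarrow> 'g list" where
  "apply_matrix scale N k n v rows A x =
     map (\<lambda>a. \<Sum>(s, j)\<in>input_coords N k n v. scale (A a (s, j)) (x s ! j)) [0..<rows]"

lemma length_apply_matrix [simp]: "length (apply_matrix scale N k n v rows A x) = rows"
  by (simp add: apply_matrix_def)

lemma linear_node_fun_iff: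
  "linear_node_fun scale N k n v rows h \<longleftrightarrow>
     (\<exists>A. \<forall>x\<in>input_space N k n v. h x = apply_matrix scale N k n v rows A x)"
  by (simp add: linear_node_fun_def apply_matrix_def)

definition messages :: "('v, 'e) network \<Rightarrow> (nat \<Rightarrow> nat) \<Rightarrow> (nat \<Rightarrow> 'a list) set" where
  "messages N k = {w. \<forall>i<num_msgs N. length (w i) = k i}"

lemma received_in_input_space:
  assumes "w \<in> messages N k" and "\<And>e. e \<in> in_arcs (net_graph N) v \<Longrightarrow> length (c e) = n"
  shows "received N w c v \<in> input_space N k n v"
  using assms by (auto simp: received_def input_space_def node_inputs_def messages_def)

text \<open>Acyclicity lets every edge be treated after the edges entering its tail, in the order in
  which \<open>carried\<close> is computed.\<close>

lemma (in network) edge_induct [consumes 1, case_names edge]: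
  assumes "e \<in> arcs (net_graph N)"
    and "\<And>e. e \<in> arcs (net_graph N) \<Longrightarrow>
      (\<And>d. d \<in> in_arcs (net_graph N) (tail (net_graph N) e) \<Longrightarrow> P d) \<Longrightarrow> P e"
  shows "P e"
  using assms(1) by (induction e rule: wf_induct_rule[OF wf_edges]) (auto intro: assms(2))


text \<open>Linear forms on the message space, given by explicit coefficients because that space is
  a set of families of lists rather than a vector space type.\<close>

definition functional ::
    "('v, 'e) network \<Rightarrow> (nat \<Rightarrow> nat) \<Rightarrow> ((nat \<Rightarrow> 'f::field list) \<Rightarrow> 'f) \<Rightarrow> bool" where
  "functional N k g \<longleftrightarrow> (\<exists>T. \<forall>w\<in>messages N k.
     g w = (\<Sum>(i, j)\<in>(SIGMA i:{..<num_msgs N}. {..<k i}). T (i, j) * w i ! j))"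

text \<open>Lists of the right length are supplied at every index, also beyond
  \<open>num_msgs N\<close>, so that \<open>unit_message_embed\<close> can be an equality of
  functions.\<close>

definition unit_message :: "(nat \<Rightarrow> nat) \<Rightarrow> nat \<Rightarrow> nat \<Rightarrow> nat \<Rightarrow> 'f::field list" where
  "unit_message k i j = (\<lambda>i'. map (\<lambda>j'. if i' = i \<and> j' = j then 1 else 0) [0..<k i'])"

section \<open>Closure properties of linear forms, and their values on unit messages\<close>

lemma functional_cong:
  assumes "functional N k g" and "\<And>w. w \<in> messages N k \<Longrightarrow> h w = g w"
  shows "functional N k h"
  using assms by (simp add: functional_def)

lemma functional_coordinate:
  assumes "i < num_msgs N" "j < k i"
  shows "functional N k (\<lambda>w. w i ! j)"
  unfolding functional_def
proof (intro exI ballI)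
  fix w :: "nat \<Rightarrow> 'f::field list"
  let ?M = "SIGMA i:{..<num_msgs N}. {..<k i}"
  have "w i ! j = (\<Sum>p\<in>?M. if p = (i, j) then w i ! j else 0)"
    using assms by (simp add: finite_SigmaI)
  also have "\<dots> = (\<Sum>(i', j')\<in>?M. (if (i', j') = (i, j) then 1 else 0) * w i' ! j')"
    by (intro sum.cong) (auto split: if_splits)
  finally show "w i ! j = (\<Sum>(i', j')\<in>?M. (\<lambda>p. if p = (i, j) then 1 else 0) (i', j') * w i' ! j')"
    by simp
qed

lemma functional_sum:
  assumes "\<And>x. x \<in> A \<Longrightarrow> functional N k (g x)"
  shows "functional N k (\<lambda>w. \<Sum>x\<in>A. c x * g x w)"
proof -
  let ?M = "SIGMA i:{..<num_msgs N}. {..<k i}"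
  have "\<forall>x\<in>A. \<exists>T. \<forall>w\<in>messages N k. g x w = (\<Sum>(i, j)\<in>?M. T (i, j) * w i ! j)"
    using assms by (simp add: functional_def)
  from bchoice[OF this] obtain T where T: "\<And>x w. x \<in> A \<Longrightarrow> w \<in> messages N k \<Longrightarrow>
      g x w = (\<Sum>(i, j)\<in>?M. T x (i, j) * w i ! j)"
    by blast
  have "(\<Sum>x\<in>A. c x * g x w) = (\<Sum>(i, j)\<in>?M. (\<Sum>x\<in>A. c x * T x (i, j)) * w i ! j)"
    if "w \<in> messages N k" for w
  proof -
    have "(\<Sum>x\<in>A. c x * g x w) = (\<Sum>x\<in>A. \<Sum>(i, j)\<in>?M. c x * T x (i, j) * w i ! j)"
      using that by (intro sum.cong) (auto simp: T sum_distrib_left case_prod_unfold mult.assoc)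
    also have "\<dots> = (\<Sum>(i, j)\<in>?M. (\<Sum>x\<in>A. c x * T x (i, j)) * w i ! j)"
      by (subst sum.swap) (simp add: sum_distrib_right case_prod_unfold)
    finally show ?thesis .
  qed
  then show ?thesis
    unfolding functional_def by (intro exI[of _ "\<lambda>p. \<Sum>x\<in>A. c x * T x p"]) blast
qed

text \<open>Evaluation at a unit message reads off one coefficient, so both forms have the same
  coefficients.\<close>

lemma functional_eqI:
  assumes "functional N k g" "functional N k h"
    and unit: "\<And>i j. i < num_msgs N \<Longrightarrow> j < k i \<Longrightarrow> g (unit_message k i j) = h (unit_message k i j)"
    and "w \<in> messages N k"
  shows "g w = h w"
proof -
  let ?M = "SIGMA i:{..<num_msgs N}. {..<k i}"
  have eval: "(\<Sum>(i', j')\<in>?M. T (i', j') * unit_message k i j i' ! j') = T (i, j)"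
    if "i < num_msgs N" "j < k i" for i j and T :: "nat \<times> nat \<Rightarrow> 'f::field"
  proof -
    have "(\<Sum>(i', j')\<in>?M. T (i', j') * unit_message k i j i' ! j') =
        (\<Sum>p\<in>?M. if p = (i, j) then T (i, j) else 0)"
      by (intro sum.cong) (auto simp: unit_message_def split: if_splits)
    then show ?thesis
      using that by (simp add: finite_SigmaI)
  qed
  have mem: "unit_message k i j \<in> messages N k" for i j
    by (simp add: unit_message_def messages_def)
  obtain T where T: "\<And>w. w \<in> messages N k \<Longrightarrow> g w = (\<Sum>(i, j)\<in>?M. T (i, j) * w i ! j)"
    using assms(1) unfolding functional_def by blast
  obtain U where U: "\<And>w. w \<in> messages N k \<Longrightarrow> h w = (\<Sum>(i, j)\<in>?M. U (i, j) * w i ! j)"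
    using assms(2) unfolding functional_def by blast
  have "T (i, j) = U (i, j)" if "i < num_msgs N" "j < k i" for i j
    using unit[OF that] trans[OF T[OF mem] eval[OF that]] trans[OF U[OF mem] eval[OF that]] by simp
  then show ?thesis
    unfolding T[OF assms(4)] U[OF assms(4)] by (intro sum.cong) auto
qed

text \<open>Every input coordinate of a node is a message coordinate or a coordinate of an incoming
  edge, and a matrix row combines these linearly.\<close>

lemma functional_apply_matrix:
  assumes "a < rows"
    and "\<And>e b. e \<in> in_arcs (net_graph N) v \<Longrightarrow> b < n \<Longrightarrow> functional N k (\<lambda>w. c w e ! b)"
  shows "functional N k (\<lambda>w. apply_matrix (*) N k n v rows A (received N w (c w) v) ! a)"
proof -
  have "functional N k (\<lambda>w. received N w (c w) v s ! j)" if "(s, j) \<in> input_coords N k n v" for s j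
    using that assms(2)
    by (auto simp: received_def input_coords_def node_inputs_def intro: functional_coordinate)
  then have "functional N k (\<lambda>w. \<Sum>p\<in>input_coords N k n v.
      A a p * (received N w (c w) v (fst p) ! snd p))"
    by (intro functional_sum) auto
  then show ?thesis
    by (rule functional_cong) (use assms(1) in \<open>simp add: apply_matrix_def case_prod_unfold\<close>)
qed

text \<open>Induction along the graph. Since \<open>f e\<close> is a matrix function on all
  arguments, the lengths of the carried vectors need not be tracked.\<close>

lemma (in network) functional_carried:
  assumes f: "\<And>e. e \<in> arcs (net_graph N) \<Longrightarrow>
      f e = apply_matrix (*) N k n (tail (net_graph N) e) n (A e)"
    and "e \<in> arcs (net_graph N)" "a < n"
  shows "functional N k (\<lambda>w. carried N f w e ! a)"
  using assms(2,3)
proof (induction arbitrary: a rule: edge_induct)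
  case (edge e)
  have "functional N k (\<lambda>w. apply_matrix (*) N k n (tail (net_graph N) e) n (A e)
      (received N w (carried N f w) (tail (net_graph N) e)) ! a)"
    using edge by (intro functional_apply_matrix)
  then show ?case
    by (rule functional_cong) (subst carried_eq[OF edge.hyps], simp add: f[OF edge.hyps])
qed


section \<open>Replacing ring elements by matrices\<close>

context module_representation
begin

text \<open>The concatenation of the coordinate vectors of the entries, each of length
  \<open>t\<close>.\<close>

definition embed :: "'g list \<Rightarrow> 'f list" where
  "embed xs = map (\<lambda>j. \<phi> (xs ! (j div t)) (j mod t)) [0..<t * length xs]"

text \<open>The block matrix in which each entry \<open>r\<close> becomes the square matrix
  \<open>\<rho> r\<close> of size \<open>t\<close>; inputs stay the same and only the positions
  within them are subdivided.\<close>

definition block :: "(nat \<Rightarrow> 'e input \<times> nat \<Rightarrow> 'r) \<Rightarrow> nat \<Rightarrow> 'e input \<times> nat \<Rightarrow> 'f" where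
  "block A a p = \<rho> (A (a div t) (fst p, snd p div t)) (a mod t) (snd p mod t)"

lemma length_embed [simp]: "length (embed xs) = t * length xs"
  by (simp add: embed_def)

lemma nth_embed: "j < t * length xs \<Longrightarrow> embed xs ! j = \<phi> (xs ! (j div t)) (j mod t)"
  by (simp add: embed_def)

lemma div_t_less: "a < t * m \<Longrightarrow> a div t < m"
  by (simp add: less_mult_imp_div_less mult.commute)

lemma \<phi>_zero:
  assumes "i < t"
  shows "\<phi> 0 i = 0"
  using \<phi>_add[OF zero_mem zero_mem assms] by (simp only: add_0_left add_cancel_right_right)

lemma sum_mem: "(\<And>x. x \<in> A \<Longrightarrow> h x \<in> S) \<Longrightarrow> (\<Sum>x\<in>A. h x) \<in> S"
  by (induction A rule: infinite_finite_induct) (auto simp: zero_mem add_mem)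

lemma \<phi>_sum:
  assumes "\<And>x. x \<in> A \<Longrightarrow> h x \<in> S" and "i < t"
  shows "\<phi> (\<Sum>x\<in>A. h x) i = (\<Sum>x\<in>A. \<phi> (h x) i)"
  using assms by (induction A rule: infinite_finite_induct) (auto simp: \<phi>_zero \<phi>_add sum_mem)

lemma input_dim_mult: "input_dim (\<lambda>i. t * k i) (t * n) s = t * input_dim k n s"
  by (cases s) auto

lemma nth_input_mem:
  assumes "x \<in> input_space N k n v" and "\<And>s. s \<in> node_inputs N v \<Longrightarrow> set (x s) \<subseteq> S"
    and "(s, j) \<in> input_coords N k n v"
  shows "x s ! j \<in> S"
  using assms by (fastforce simp: input_space_def input_coords_def PiE_iff)

lemma set_apply_matrix:
  assumes "x \<in> input_space N k n v" and "\<And>s. s \<in> node_inputs N v \<Longrightarrow> set (x s) \<subseteq> S"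
  shows "set (apply_matrix (*s) N k n v rows A x) \<subseteq> S"
  by (auto simp: apply_matrix_def intro!: sum_mem scale_mem nth_input_mem[OF assms])

text \<open>On \<open>S\<close>, \<open>\<phi>\<close> is additive and turns the action of
  \<open>r\<close> into multiplication by \<open>\<rho> r\<close>, so it turns each row of the old
  matrix into a row of blocks.\<close>

lemma apply_matrix_block:
  assumes x: "x \<in> input_space N k n v" "\<And>s. s \<in> node_inputs N v \<Longrightarrow> set (x s) \<subseteq> S"
    and y: "\<And>s. s \<in> node_inputs N v \<Longrightarrow> y s = embed (x s)"
  shows "apply_matrix (*) N (\<lambda>i. t * k i) (t * n) v (t * rows) (block A) y =
    embed (apply_matrix (*s) N k n v rows A x)"
proof (rule nth_equalityI)
  let ?C = "input_coords N k n v" and ?C' = "input_coords N (\<lambda>i. t * k i) (t * n) v"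
  fix a assume "a < length (apply_matrix (*) N (\<lambda>i. t * k i) (t * n) v (t * rows) (block A) y)"
  then have a: "a < t * rows" "a div t < rows" "a mod t < t"
    using t_pos by (auto simp: div_t_less)
  have len: "length (x s) = input_dim k n s" if "s \<in> node_inputs N v" for s
    using x(1) that by (auto simp: input_space_def)
  have "embed (apply_matrix (*s) N k n v rows A x) ! a =
      \<phi> (\<Sum>p\<in>?C. A (a div t) p *s (x (fst p) ! snd p)) (a mod t)"
    using a by (simp add: nth_embed) (simp add: apply_matrix_def case_prod_unfold)
  also have "\<dots> = (\<Sum>p\<in>?C. \<phi> (A (a div t) p *s (x (fst p) ! snd p)) (a mod t))"
    by (rule \<phi>_sum) (use a nth_input_mem[OF x] in \<open>auto intro!: scale_mem\<close>)
  also have "\<dots> = (\<Sum>p\<in>?C. \<Sum>l<t. \<rho> (A (a div t) p) (a mod t) l * \<phi> (x (fst p) ! snd p) l)"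
    by (rule sum.cong[OF refl], rule \<phi>_scale) (use a nth_input_mem[OF x] in auto)
  also have "\<dots> = (\<Sum>(p, l)\<in>?C \<times> {..<t}.
      \<rho> (A (a div t) p) (a mod t) l * \<phi> (x (fst p) ! snd p) l)"
    by (rule sum.cartesian_product)
  \<comment> \<open>Division with remainder by \<open>t\<close>: position \<open>j * t + l\<close>
    of input \<open>s\<close> is place \<open>l\<close> in the block of the old position
    \<open>j\<close>.\<close>
  also have "\<dots> = (\<Sum>q\<in>?C'. block A a q * y (fst q) ! snd q)"
  proof (rule sum.reindex_bij_witness
      [where j = "\<lambda>(p, l). (fst p, snd p * t + l)" and i = "\<lambda>q. ((fst q, snd q div t), snd q mod t)"])
    fix q assume q: "q \<in> ?C \<times> {..<t}"
    obtain s j l where [simp]: "q = ((s, j), l)"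
      by (metis surj_pair)
    have l: "l < t" and s: "s \<in> node_inputs N v" and j: "j < input_dim k n s"
      using q by (auto simp: input_coords_def)
    have "j * t + l < Suc j * t"
      using l by simp
    also have "\<dots> \<le> input_dim k n s * t"
      using j by (intro mult_right_mono) auto
    finally have bound: "j * t + l < t * input_dim k n s"
      by (simp add: mult.commute)
    show "((fst (case q of (p, l) \<Rightarrow> (fst p, snd p * t + l)),
        snd (case q of (p, l) \<Rightarrow> (fst p, snd p * t + l)) div t),
        snd (case q of (p, l) \<Rightarrow> (fst p, snd p * t + l)) mod t) = q"
      using l by simp
    show "(case q of (p, l) \<Rightarrow> (fst p, snd p * t + l)) \<in> ?C'"
      using s bound by (simp add: input_coords_def input_dim_mult)
    show "block A a (case q of (p, l) \<Rightarrow> (fst p, snd p * t + l)) *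
        y (fst (case q of (p, l) \<Rightarrow> (fst p, snd p * t + l))) !
          snd (case q of (p, l) \<Rightarrow> (fst p, snd p * t + l)) =
        (case q of (p, l) \<Rightarrow> \<rho> (A (a div t) p) (a mod t) l * \<phi> (x (fst p) ! snd p) l)"
      using l s bound by (simp add: block_def y nth_embed len)
  next
    fix q assume "q \<in> ?C'"
    then show "((fst q, snd q div t), snd q mod t) \<in> ?C \<times> {..<t}"
      using t_pos by (auto simp: input_coords_def input_dim_mult div_t_less)
  qed simp
  also have "\<dots> = apply_matrix (*) N (\<lambda>i. t * k i) (t * n) v (t * rows) (block A) y ! a"
    using a by (simp add: apply_matrix_def case_prod_unfold)
  finally show "apply_matrix (*) N (\<lambda>i. t * k i) (t * n) v (t * rows) (block A) y ! a =
      embed (apply_matrix (*s) N k n v rows A x) ! a" ..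
qed simp

section \<open>Simulation of the original code by the block code\<close>

lemma embed_received:
  assumes "s \<in> node_inputs N v"
    and "\<And>e. e \<in> in_arcs (net_graph N) v \<Longrightarrow> c' e = embed (c e)"
  shows "received N (embed \<circ> w) c' v s = embed (received N w c v s)"
  using assms by (auto simp: received_def node_inputs_def)

lemma set_received:
  assumes "s \<in> node_inputs N v" and "\<And>i. i < num_msgs N \<Longrightarrow> set (w i) \<subseteq> S"
    and "\<And>e. e \<in> in_arcs (net_graph N) v \<Longrightarrow> set (c e) \<subseteq> S"
  shows "set (received N w c v s) \<subseteq> S"
  using assms by (fastforce simp: received_def node_inputs_def)

text \<open>Length and membership in \<open>S\<close> are part of the induction because
  \<open>f\<close> is known to be a matrix function only on \<open>input_space\<close>, and
  \<open>\<phi>\<close> to be linear only on \<open>S\<close>.\<close>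

lemma carried_embed:
  assumes "network N"
    and f: "\<And>e x. e \<in> arcs (net_graph N) \<Longrightarrow> x \<in> input_space N k n (tail (net_graph N) e) \<Longrightarrow>
      f e x = apply_matrix (*s) N k n (tail (net_graph N) e) n (A e) x"
    and f': "\<And>e. e \<in> arcs (net_graph N) \<Longrightarrow>
      f' e = apply_matrix (*) N (\<lambda>i. t * k i) (t * n) (tail (net_graph N) e) (t * n) (block (A e))"
    and w: "w \<in> messages N k" "\<And>i. i < num_msgs N \<Longrightarrow> set (w i) \<subseteq> S"
    and "e \<in> arcs (net_graph N)"
  shows "length (carried N f w e) = n \<and> set (carried N f w e) \<subseteq> S \<and>
    carried N f' (embed \<circ> w) e = embed (carried N f w e)"
proof -
  interpret network N by fact
  show ?thesis
    using assms(6)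
  proof (induction rule: edge_induct)
    case (edge e)
    let ?v = "tail (net_graph N) e"
    let ?x = "received N w (carried N f w) ?v"
    have x: "?x \<in> input_space N k n ?v"
      using edge.IH by (intro received_in_input_space w) auto
    have S: "set (?x s) \<subseteq> S" if "s \<in> node_inputs N ?v" for s
      using that edge.IH by (intro set_received w) auto
    have "received N (embed \<circ> w) (carried N f' (embed \<circ> w)) ?v s = embed (?x s)"
      if "s \<in> node_inputs N ?v" for s
      using that edge.IH by (intro embed_received) blast+
    note apply_matrix_block[OF x S this, where rows = n and A = "A e"]
    then show ?case
      using carried_eq[OF edge.hyps, of f w] carried_eq[OF edge.hyps, of f' "embed \<circ> w"]
        f[OF edge.hyps x] f'[OF edge.hyps] set_apply_matrix[OF x S] by (simp add: comp_def)
  qed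
qed

text \<open>\<open>\<phi>\<close> maps basis vectors to unit vectors, so every unit message over the
  field comes from a message over \<open>S\<close>.\<close>

lemma unit_message_embed:
  fixes k :: "nat \<Rightarrow> nat"
  assumes "j < t * k i"
  defines "w \<equiv> \<lambda>i'. map (\<lambda>j'. if i' = i \<and> j' = j div t then b (j mod t) else 0) [0..<k i']"
  shows "unit_message (\<lambda>i. t * k i) i j = embed \<circ> w"
proof
  fix i'
  show "unit_message (\<lambda>i. t * k i) i j i' = (embed \<circ> w) i'"
  proof (rule nth_equalityI)
    fix j' assume "j' < length (unit_message (\<lambda>i. t * k i) i j i' :: 'f list)"
    then have j': "j' < t * k i'"
      by (simp add: unit_message_def)
    \<comment> \<open>Equal positions means same block and same offset: in the right block
      \<open>\<phi>_basis\<close> supplies the single 1, elsewhere \<open>\<phi>_zero\<close>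
      applies.\<close>
    have "j' = j \<longleftrightarrow> j' div t = j div t \<and> j' mod t = j mod t"
      by (metis div_mult_mod_eq)
    then show "unit_message (\<lambda>i. t * k i) i j i' ! j' = (embed \<circ> w) i' ! j'"
      using j' t_pos by (auto simp: unit_message_def w_def nth_embed div_t_less \<phi>_basis \<phi>_zero)
  qed (simp add: unit_message_def w_def)
qed

text \<open>Simulation settles only embedded messages; linearity over the field extends correct
  decoding to all others.\<close>

theorem has_linear_solution_blocks:
  assumes "finite (UNIV :: 'f set)" and "has_linear_solution (*s) N k n"
  shows "has_linear_solution ((*) :: 'f \<Rightarrow> 'f \<Rightarrow> 'f) N (\<lambda>i. t * k i) (t * n)"
proof -
  obtain f d where code: "network_code N k n f d"
    and edges: "\<And>e. e \<in> arcs (net_graph N) \<Longrightarrow>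
      linear_node_fun (*s) N k n (tail (net_graph N) e) n (f e)"
    and decoders: "\<And>v i. v \<in> receivers N \<Longrightarrow> i \<in> demands N v \<Longrightarrow>
      linear_node_fun (*s) N k n v (k i) (d v i)"
    and solution: "\<And>w v i. w \<in> messages N k \<Longrightarrow> v \<in> receivers N \<Longrightarrow> i \<in> demands N v \<Longrightarrow>
      d v i (received N w (carried N f w) v) = w i"
    using assms(2) unfolding has_linear_solution_def is_linear_code_def is_solution_def messages_def
    by blast
  interpret network_code N k n f d by fact
  have N: "network N"
    by unfold_locales
  obtain A where A: "\<And>e x. e \<in> arcs (net_graph N) \<Longrightarrow>
      x \<in> input_space N k n (tail (net_graph N) e) \<Longrightarrow>
      f e x = apply_matrix (*s) N k n (tail (net_graph N) e) n (A e) x"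
    using edges unfolding linear_node_fun_iff by metis
  obtain D where D: "\<And>v i x. v \<in> receivers N \<Longrightarrow> i \<in> demands N v \<Longrightarrow> x \<in> input_space N k n v \<Longrightarrow>
      d v i x = apply_matrix (*s) N k n v (k i) (D v i) x"
    using decoders unfolding linear_node_fun_iff by metis
  let ?k = "\<lambda>i. t * k i" and ?n = "t * n"
  define f' where
    "f' e = apply_matrix ((*) :: 'f \<Rightarrow> _) N ?k ?n (tail (net_graph N) e) ?n (block (A e))" for e
  define d' where "d' v i = apply_matrix ((*) :: 'f \<Rightarrow> _) N ?k ?n v (?k i) (block (D v i))" for v i
  have code': "network_code N ?k ?n f' d'"
  proof unfold_locales
    show "finite (UNIV :: 'f set)" by fact
    then show "2 \<le> card (UNIV :: 'f set)"
      using card_mono[of "UNIV :: 'f set" "{0, 1}"] by simp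
    show "1 \<le> ?n"
      using n_pos t_pos by (simp add: Suc_le_eq)
  qed (auto simp: f'_def d'_def)
  \<comment> \<open>The old decoder returns \<open>w i\<close>, so the simulating one returns its
    embedding.\<close>
  have embedded: "d' v i (received N (embed \<circ> w) (carried N f' (embed \<circ> w)) v) = embed (w i)"
    if w: "w \<in> messages N k" "\<And>i. i < num_msgs N \<Longrightarrow> set (w i) \<subseteq> S"
      and vi: "v \<in> receivers N" "i \<in> demands N v" for w v i
  proof -
    note carried = carried_embed[OF N A f'_def w]
    let ?x = "received N w (carried N f w) v"
    have x: "?x \<in> input_space N k n v"
      using carried by (intro received_in_input_space w) auto
    have S: "set (?x s) \<subseteq> S" if "s \<in> node_inputs N v" for s
      using that carried by (intro set_received w) auto
    have "received N (embed \<circ> w) (carried N f' (embed \<circ> w)) v s = embed (?x s)"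
      if "s \<in> node_inputs N v" for s
      using that carried by (intro embed_received) auto
    from apply_matrix_block[OF x S this, where rows = "k i" and A = "D v i"]
    show ?thesis
      using solution[OF w(1) vi] D[OF vi x] by (simp add: d'_def)
  qed
  have "d' v i (received N w (carried N f' w) v) = w i"
    if w: "w \<in> messages N ?k" and vi: "v \<in> receivers N" "i \<in> demands N v" for w v i
  proof (rule nth_equalityI)
    have i: "i < num_msgs N"
      using demands_subset[OF vi(1)] vi(2) by auto
    show "length (d' v i (received N w (carried N f' w) v)) = length (w i)"
      using w i by (simp add: d'_def messages_def)
    fix a assume "a < length (d' v i (received N w (carried N f' w) v))"
    then have a: "a < t * k i"
      by (simp add: d'_def)
    show "d' v i (received N w (carried N f' w) v) ! a = w i ! a"
    \<comment> \<open>Both sides are linear forms in the message, so only unit messages have to be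
      checked.\<close>
    proof (rule functional_eqI[OF _ _ _ w])
      show "functional N ?k (\<lambda>w. d' v i (received N w (carried N f' w) v) ! a)"
        unfolding d'_def
        by (rule functional_apply_matrix[OF a], rule functional_carried[OF f'_def]) auto
      show "functional N ?k (\<lambda>w. w i ! a)"
        using i a by (rule functional_coordinate)
    next
      fix i' j assume j: "j < t * k i'"
      \<comment> \<open>The message over \<open>S\<close> whose embedding is the unit
        message.\<close>
      let ?w = "\<lambda>i''. map (\<lambda>j'. if i'' = i' \<and> j' = j div t then b (j mod t) else 0) [0..<k i'']"
      have "?w \<in> messages N k"
        by (simp add: messages_def)
      moreover have "set (?w i'') \<subseteq> S" for i''
        using t_pos by (auto simp: basis_mem zero_mem)
      ultimately show "d' v i (received N (unit_message ?k i' j) (carried N f' (unit_message ?k i' j)) v) ! a =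
          unit_message ?k i' j i ! a"
        using embedded[OF _ _ vi] by (simp add: unit_message_embed[where i = i' and k = k, OF j])
    qed
  qed
  then have "is_solution N ?k ?n f' d'"
    using code' by (simp add: is_solution_def messages_def)
  moreover have "is_linear_code (*) N ?k ?n f' d'"
    using code' by (simp add: is_linear_code_def f'_def d'_def linear_node_fun_iff) blast
  ultimately show ?thesis
    unfolding has_linear_solution_def by blast
qed

end

theorem theorem4p1:
  fixes scale :: "'r::ring_1 \<Rightarrow> 'g::{ab_group_add, finite} \<Rightarrow> 'g"
    and N :: "('v, 'e) network"
    and k :: "nat \<Rightarrow> nat" and n :: nat
  assumes "left_module scale"
    and "CHAR('f::{field, finite}) dvd card (UNIV :: 'g set)"
    and "network N"
    and "1 \<le> n"
    and "has_linear_solution scale N k n"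
  shows "\<exists>t::nat. 0 < t \<and>
    has_linear_solution ((*) :: 'f \<Rightarrow> 'f \<Rightarrow> 'f) N (\<lambda>i. t * k i) (t * n)"
proof -
  interpret left_module scale by fact
  \<comment> \<open>\<open>t\<close> is obtained from the module and the field alone, so the same
    \<open>t\<close> serves all networks.\<close>
  obtain S t b and \<phi> :: "'g \<Rightarrow> nat \<Rightarrow> 'f" and \<rho> where
    "module_representation scale S t b \<phi> \<rho>"
    using torsion_representation[OF finite assms(2)] by blast
  then interpret module_representation scale S t b \<phi> \<rho> .
  show ?thesis
    using t_pos has_linear_solution_blocks[OF finite assms(5)] by blast
qed

end
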